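(* Let $\mathbf A$ be a finite Boolean algebra with atoms $\alpha_1,\ldots,\alpha_n$. The set of atoms of the Boolean algebra $\mathcal{T}(\mathbf A)$ is exactly $\{[\omega_{\langle\beta\rangle}] : \langle\beta\rangle=\langle\beta_1,\ldots,\beta_{n-1}\rangle$ a sequence of pairwise different atoms of $\mathbf A\}$, where $\omega_{\langle\beta\rangle}=(\beta_1\mid\top)\wedge(\beta_2\mid\overline{\beta_1})\wedge\cdots\wedge(\beta_{n-1}\mid\overline{\beta_1}\wedge\cdots\wedge\overline{\beta_{n-2}})$.
   Context: $\mathbf A=(A,\wedge,\vee,\neg,\bot,\top)$ is a finite Boolean algebra; $ab=a\wedge b$, $\bar a=\neg a$, $A'=A\setminus\{\bot\}$. $\Omega$ is the set of Boolean homomorphisms $w:\mathbf A\to\{0,1\}$ (identified with atoms); $w\models a$ means $w(a)=1$. A basic conditional is a pair $(a\mid b)$, $a\in A$, $b\in A'$. $\mathbb{T}(A)$ is the set of terms built from basic conditionals (as variables) and constants $0,1$ using $\neg,\wedge,\vee$. $\mathbf b(t)$ is the disjunction of antecedents of basic conditionals occurring in $t$ ($\top$ if $t\in\{0,1\}$). The $w$-reduct $t^w$: replace each occurring $(a_i\mid b_i)$ by $1$ if $w\models a_ib_i$, by $0$ if $w\models\bar a_ib_i$ (unchanged if $w\models\bar b_i$), then apply $\neg1:=0$, $\neg0:=1$, $r\wedge1=1\wedge r:=r$, $r\wedge0=0\wedge r:=0$, $r\vee1=1\vee r:=1$, $r\vee0=0\vee r:=r$ until no rule applies. A conditional probability on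 $A\times A'$ is $P:A\times A'\to[0,1]$ with $P(\cdot\mid b)$ a finitely additive probability for each $b\in A'$, $P(b\mid b)=1$, $P(ab\mid c)=P(a\mid bc)P(b\mid c)$; $\mathbb P(X\mid b)=\sum_wX(w)P(w\mid b)$. Given $P$, $X_t:\Omega\to[0,1]$ is defined recursively by $X_1\equiv1$, $X_0\equiv0$, $X_t(w)=\mathbb P(X_{t^w}\mid\mathbf b(t^w))$ (for $w\models\neg\mathbf b(t)$, $t^w=t$ and $X_t(w)=\mathbb P(X_t\mid\mathbf b(t))$). $t\equiv s$ iff $X_t=X_s$ for every conditional probability on $A\times A'$; $\mathcal{T}(\mathbf A)$ is the Boolean algebra $\mathbb{T}(A)/\!\equiv$ with $[t]\wedge^*[s]=[t\wedge s]$, $[t]\vee^*[s]=[t\vee s]$, $\neg^*[t]=[\neg t]$, $0=[(\bot\mid\top)]$, $1=[(\top\mid\top)]$. *)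

theory Defs
  imports Complex_Main
begin

text \<open>The finite Boolean algebra \<open>A\<close> is a type of sort \<open>{finite, boolean_algebra}\<close>; \<open>A'\<close> is
  the set of its elements different from \<open>bot\<close>. Worlds are identified with atoms:
  the atom \<open>w\<close> stands for the homomorphism \<open>\<lambda>a. w \<le> a\<close>, so \<open>w \<Turnstile> a\<close> is written \<open>w \<le> a\<close>.
  The lemmas \<open>worlds_hom\<close> and \<open>hom_worlds\<close> below justify this.\<close>

definition worlds :: "'a::boolean_algebra set" where
  "worlds = {w. w \<noteq> bot \<and> (\<forall>a. a \<le> w \<longrightarrow> a = bot \<or> a = w)}"

definition bool_hom :: "('a::boolean_algebra \<Rightarrow> bool) \<Rightarrow> bool" where
  "bool_hom h \<longleftrightarrow> \<not> h bot \<and> h top \<and> (\<forall>a b. h (inf a b) = (h a \<and> h b)) \<and>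
     (\<forall>a b. h (sup a b) = (h a \<or> h b)) \<and> (\<forall>a. h (- a) = (\<not> h a))"

lemma world_le_or_disjoint: "w \<in> worlds \<Longrightarrow> w \<le> a \<or> inf w a = bot"
proof -
  assume "w \<in> worlds"
  moreover have "inf w a \<le> w" by (rule inf_le1)
  ultimately have "inf w a = bot \<or> inf w a = w" by (simp add: worlds_def)
  then show ?thesis by (auto simp: inf.absorb_iff1)
qed

lemma world_le_sup: "w \<in> worlds \<Longrightarrow> w \<le> sup a b \<longleftrightarrow> w \<le> a \<or> w \<le> b"
proof
  assume w: "w \<in> worlds" and le: "w \<le> sup a b"
  show "w \<le> a \<or> w \<le> b"
  proof (rule ccontr)
    assume "\<not> (w \<le> a \<or> w \<le> b)"
    then have "inf w a = bot" "inf w b = bot" using world_le_or_disjoint w by blast+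
    then have "inf w (sup a b) = bot" by (simp add: inf_sup_distrib1)
    then show False using le w by (simp add: inf.absorb1 worlds_def)
  qed
qed (auto intro: le_supI1 le_supI2)

lemma world_le_compl: "w \<in> worlds \<Longrightarrow> w \<le> - a \<longleftrightarrow> \<not> w \<le> a"
proof -
  assume w: "w \<in> worlds"
  have "w \<le> a \<or> w \<le> - a" using world_le_sup[OF w, of a "- a"] by simp
  moreover have "\<not> (w \<le> a \<and> w \<le> - a)"
  proof
    assume "w \<le> a \<and> w \<le> - a"
    then have "w \<le> inf a (- a)" by (simp only: le_inf_iff)
    then have "w \<le> bot" by (simp only: inf_compl_bot)
    then show False using w by (simp add: worlds_def bot_unique)
  qed
  ultimately show ?thesis by blast
qed

lemma worlds_hom: "w \<in> worlds \<Longrightarrow> bool_hom (\<lambda>a. w \<le> a)"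
  unfolding bool_hom_def
  by (simp add: world_le_sup world_le_compl bot_unique) (simp add: worlds_def)

lemma hom_worlds:
  fixes h :: "'a::{finite,boolean_algebra} \<Rightarrow> bool"
  assumes h: "bool_hom h"
  shows "\<exists>!w. w \<in> worlds \<and> h = (\<lambda>a. w \<le> a)"
proof -
  have h_inf: "h (inf a b) = (h a \<and> h b)" and h_compl: "h (- a) = (\<not> h a)" for a b
    using h by (auto simp: bool_hom_def)
  have fin: "finite {a. h a}" and ne: "{a. h a} \<noteq> {}"
    using h by (auto simp: bool_hom_def)
  define w where "w = Inf_fin {a. h a}"
  have "h (Inf_fin B)" if "finite B" "B \<noteq> {}" "B \<subseteq> {a. h a}" for B
    using that by (induction B rule: finite_ne_induct) (auto simp: h_inf)
  then have hw: "h w" using fin ne by (simp add: w_def)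
  have eq: "h a \<longleftrightarrow> w \<le> a" for a
  proof
    assume "h a" then show "w \<le> a" using fin by (simp add: w_def Inf_fin.coboundedI)
  next
    assume "w \<le> a" then have "inf w a = w" by (simp add: inf.absorb1)
    then show "h a" using hw h_inf[of w a] by simp
  qed
  have "w \<noteq> bot" using hw h by (auto simp: bool_hom_def)
  moreover have "a = bot \<or> a = w" if "a \<le> w" for a
  proof (cases "h a")
    case True then have "a = w" using eq that by (intro antisym) auto
    then show ?thesis by simp
  next
    case False
    then have "w \<le> - a" using h_compl eq by blast
    then have "a \<le> - a" using that by (rule order_trans[rotated])
    then have "inf a (- a) = a" by (rule inf.absorb1)
    then have "a = bot" by simp
    then show ?thesis by simp
  qed
  ultimately have ex: "w \<in> worlds" by (simp add: worlds_def)
  have uniq: "v = w" if "h = (\<lambda>a. v \<le> a)" for v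
  proof (rule antisym)
    have "v \<le> a \<longleftrightarrow> w \<le> a" for a using eq[of a] that by simp
    then show "v \<le> w" and "w \<le> v" by blast+
  qed
  have "h = (\<lambda>a. w \<le> a)" using eq by (intro ext) simp
  with ex show ?thesis by (intro ex1I[of _ w] conjI uniq) (erule conjunct2 | assumption)+
qed


datatype 'a cterm =
    Zero
  | One
  | Cond 'a 'a
  | Neg "'a cterm"
  | Conj "'a cterm" "'a cterm"
  | Disj "'a cterm" "'a cterm"

text \<open>\<open>Cond a b\<close> is the basic conditional \<open>(a | b)\<close>. The type also contains \<open>Cond a bot\<close>;
  the terms over \<open>A\<close> are those in which every antecedent is different from \<open>bot\<close>.\<close>

primrec wf_cterm :: "'a::boolean_algebra cterm \<Rightarrow> bool" where
  "wf_cterm Zero \<longleftrightarrow> True"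
| "wf_cterm One \<longleftrightarrow> True"
| "wf_cterm (Cond a b) \<longleftrightarrow> b \<noteq> bot"
| "wf_cterm (Neg t) \<longleftrightarrow> wf_cterm t"
| "wf_cterm (Conj t s) \<longleftrightarrow> wf_cterm t \<and> wf_cterm s"
| "wf_cterm (Disj t s) \<longleftrightarrow> wf_cterm t \<and> wf_cterm s"

definition cterms :: "'a::boolean_algebra cterm set" where
  "cterms = {t. wf_cterm t}"

primrec disj_antecedents :: "'a::boolean_algebra cterm \<Rightarrow> 'a" where
  "disj_antecedents Zero = bot"
| "disj_antecedents One = bot"
| "disj_antecedents (Cond a b) = b"
| "disj_antecedents (Neg t) = disj_antecedents t"
| "disj_antecedents (Conj t s) = sup (disj_antecedents t) (disj_antecedents s)"
| "disj_antecedents (Disj t s) = sup (disj_antecedents t) (disj_antecedents s)"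

definition bb :: "'a::boolean_algebra cterm \<Rightarrow> 'a" where
  "bb t = (if t = Zero \<or> t = One then top else disj_antecedents t)"


text \<open>The \<open>w\<close>-reduct: \<open>subst_world\<close> replaces the basic conditionals decided by \<open>w\<close>, and
  \<open>norm_cterm\<close> computes the normal form for the rewrite rules \<open>simp_step\<close>
  (lemma \<open>norm_cterm_iff\<close>).\<close>

primrec subst_world :: "'a::boolean_algebra \<Rightarrow> 'a cterm \<Rightarrow> 'a cterm" where
  "subst_world w Zero = Zero"
| "subst_world w One = One"
| "subst_world w (Cond a b) =
     (if w \<le> inf a b then One else if w \<le> inf (- a) b then Zero else Cond a b)"
| "subst_world w (Neg t) = Neg (subst_world w t)"
| "subst_world w (Conj t s) = Conj (subst_world w t) (subst_world w s)"
| "subst_world w (Disj t s) = Disj (subst_world w t) (subst_world w s)"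

inductive simp_step :: "'a cterm \<Rightarrow> 'a cterm \<Rightarrow> bool" where
  "simp_step (Neg One) Zero"
| "simp_step (Neg Zero) One"
| "simp_step (Conj r One) r"
| "simp_step (Conj One r) r"
| "simp_step (Conj r Zero) Zero"
| "simp_step (Conj Zero r) Zero"
| "simp_step (Disj r One) One"
| "simp_step (Disj One r) One"
| "simp_step (Disj r Zero) r"
| "simp_step (Disj Zero r) r"
| "simp_step t t' \<Longrightarrow> simp_step (Neg t) (Neg t')"
| "simp_step t t' \<Longrightarrow> simp_step (Conj t s) (Conj t' s)"
| "simp_step s s' \<Longrightarrow> simp_step (Conj t s) (Conj t s')"
| "simp_step t t' \<Longrightarrow> simp_step (Disj t s) (Disj t' s)"
| "simp_step s s' \<Longrightarrow> simp_step (Disj t s) (Disj t s')"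

definition mk_neg :: "'a cterm \<Rightarrow> 'a cterm" where
  "mk_neg t = (if t = One then Zero else if t = Zero then One else Neg t)"

definition mk_conj :: "'a cterm \<Rightarrow> 'a cterm \<Rightarrow> 'a cterm" where
  "mk_conj t s =
     (if s = One then t else if t = One then s
      else if t = Zero \<or> s = Zero then Zero else Conj t s)"

definition mk_disj :: "'a cterm \<Rightarrow> 'a cterm \<Rightarrow> 'a cterm" where
  "mk_disj t s =
     (if s = Zero then t else if t = Zero then s
      else if t = One \<or> s = One then One else Disj t s)"

lemmas mk_defs = mk_neg_def mk_conj_def mk_disj_def

primrec norm_cterm :: "'a cterm \<Rightarrow> 'a cterm" where
  "norm_cterm Zero = Zero"
| "norm_cterm One = One"
| "norm_cterm (Cond a b) = Cond a b"
| "norm_cterm (Neg t) = mk_neg (norm_cterm t)"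
| "norm_cterm (Conj t s) = mk_conj (norm_cterm t) (norm_cterm s)"
| "norm_cterm (Disj t s) = mk_disj (norm_cterm t) (norm_cterm s)"

lemma simp_step_norm: "simp_step t s \<Longrightarrow> norm_cterm t = norm_cterm s"
  by (induction rule: simp_step.induct) (auto simp: mk_defs)

lemma simp_steps_norm: "simp_step\<^sup>*\<^sup>* t s \<Longrightarrow> norm_cterm t = norm_cterm s"
  by (induction rule: rtranclp_induct) (auto dest: simp_step_norm)

lemma simp_steps_Neg: "simp_step\<^sup>*\<^sup>* t t' \<Longrightarrow> simp_step\<^sup>*\<^sup>* (Neg t) (Neg t')"
  by (induction rule: rtranclp_induct) (simp, erule rtranclp.rtrancl_into_rtrancl, erule simp_step.intros)

lemma simp_steps_Conj:
  assumes "simp_step\<^sup>*\<^sup>* t t'" "simp_step\<^sup>*\<^sup>* s s'"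
  shows "simp_step\<^sup>*\<^sup>* (Conj t s) (Conj t' s')"
proof -
  have "simp_step\<^sup>*\<^sup>* (Conj t s) (Conj t' s)" using assms(1)
    by (induction rule: rtranclp_induct) (simp, erule rtranclp.rtrancl_into_rtrancl, erule simp_step.intros)
  also have "simp_step\<^sup>*\<^sup>* (Conj t' s) (Conj t' s')" using assms(2)
    by (induction rule: rtranclp_induct) (simp, erule rtranclp.rtrancl_into_rtrancl, erule simp_step.intros)
  finally show ?thesis .
qed

lemma simp_steps_Disj:
  assumes "simp_step\<^sup>*\<^sup>* t t'" "simp_step\<^sup>*\<^sup>* s s'"
  shows "simp_step\<^sup>*\<^sup>* (Disj t s) (Disj t' s')"
proof -
  have "simp_step\<^sup>*\<^sup>* (Disj t s) (Disj t' s)" using assms(1)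
    by (induction rule: rtranclp_induct) (simp, erule rtranclp.rtrancl_into_rtrancl, erule simp_step.intros)
  also have "simp_step\<^sup>*\<^sup>* (Disj t' s) (Disj t' s')" using assms(2)
    by (induction rule: rtranclp_induct) (simp, erule rtranclp.rtrancl_into_rtrancl, erule simp_step.intros)
  finally show ?thesis .
qed

lemma mk_simp_steps:
  "simp_step\<^sup>*\<^sup>* (Neg t) (mk_neg t)"
  "simp_step\<^sup>*\<^sup>* (Conj t s) (mk_conj t s)"
  "simp_step\<^sup>*\<^sup>* (Disj t s) (mk_disj t s)"
  unfolding mk_defs by (auto intro!: r_into_rtranclp intro: simp_step.intros)

lemma simp_steps_to_norm: "simp_step\<^sup>*\<^sup>* t (norm_cterm t)"
proof (induction t)
  case (Neg t)
  show ?case using rtranclp_trans[OF simp_steps_Neg[OF Neg] mk_simp_steps(1)] by simp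
next
  case (Conj t s)
  show ?case using rtranclp_trans[OF simp_steps_Conj[OF Conj] mk_simp_steps(2)] by simp
next
  case (Disj t s)
  show ?case using rtranclp_trans[OF simp_steps_Disj[OF Disj] mk_simp_steps(3)] by simp
qed simp_all

inductive_cases simp_step_ZeroE: "simp_step Zero s"
inductive_cases simp_step_OneE: "simp_step One s"
inductive_cases simp_step_CondE: "simp_step (Cond a b) s"
inductive_cases simp_step_NegE: "simp_step (Neg t) s"
inductive_cases simp_step_ConjE: "simp_step (Conj t u) s"
inductive_cases simp_step_DisjE: "simp_step (Disj t u) s"

lemma norm_irreducible: "\<not> simp_step (norm_cterm t) s"
proof (induction t arbitrary: s)
  case (Neg t)
  then show ?case by (auto simp: mk_neg_def elim!: simp_step_ZeroE simp_step_OneE simp_step_NegE)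
next
  case (Conj t u)
  then show ?case by (auto simp: mk_conj_def elim!: simp_step_ZeroE simp_step_ConjE)
next
  case (Disj t u)
  then show ?case by (auto simp: mk_disj_def elim!: simp_step_OneE simp_step_DisjE)
qed (auto elim: simp_step_ZeroE simp_step_OneE simp_step_CondE)

lemma norm_cterm_iff: "norm_cterm t = s \<longleftrightarrow> simp_step\<^sup>*\<^sup>* t s \<and> (\<forall>u. \<not> simp_step s u)"
proof
  assume R: "simp_step\<^sup>*\<^sup>* t s \<and> (\<forall>u. \<not> simp_step s u)"
  then have "norm_cterm s = s"
    using simp_steps_to_norm[of s] by (auto elim: converse_rtranclpE)
  then show "norm_cterm t = s" using R simp_steps_norm by metis
qed (use simp_steps_to_norm norm_irreducible in blast)

definition reduct :: "'a::boolean_algebra \<Rightarrow> 'a cterm \<Rightarrow> 'a cterm" where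
  "reduct w t = norm_cterm (subst_world w t)"


text \<open>\<open>P a b\<close> stands for \<open>P(a | b)\<close>; the values \<open>P a bot\<close> lie outside the domain and are
  left unconstrained. The product rule is required whenever both of its conditions are
  different from \<open>bot\<close>.\<close>

definition cond_prob :: "('a::boolean_algebra \<Rightarrow> 'a \<Rightarrow> real) \<Rightarrow> bool" where
  "cond_prob P \<longleftrightarrow>
     (\<forall>a b. b \<noteq> bot \<longrightarrow> 0 \<le> P a b \<and> P a b \<le> 1) \<and>
     (\<forall>b. b \<noteq> bot \<longrightarrow> P top b = 1) \<and>
     (\<forall>a c b. b \<noteq> bot \<longrightarrow> inf a c = bot \<longrightarrow> P (sup a c) b = P a b + P c b) \<and>
     (\<forall>b. b \<noteq> bot \<longrightarrow> P b b = 1) \<and>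
     (\<forall>a b c. inf b c \<noteq> bot \<longrightarrow> P (inf a b) c = P a (inf b c) * P b c)"

definition cond_expect :: "('a::boolean_algebra \<Rightarrow> 'a \<Rightarrow> real) \<Rightarrow> ('a \<Rightarrow> real) \<Rightarrow> 'a \<Rightarrow> real" where
  "cond_expect P X b = (\<Sum>w\<in>worlds. X w * P w b)"

lemma cond_expect_cong [fundef_cong]:
  "P = P' \<Longrightarrow> b = b' \<Longrightarrow> (\<And>w. w \<in> worlds \<Longrightarrow> X w = Y w) \<Longrightarrow>
    cond_expect P X b = cond_expect P' Y b'"
  by (simp add: cond_expect_def)


text \<open>In \<open>X\<^sub>t(w) = \<P>(X\<^bsub>t\<^sup>w\<^esub> | b(t\<^sup>w))\<close> the worlds outside \<open>b(t\<^sup>w)\<close> have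
  probability \<open>0\<close>. They are cut off in the definition of \<open>rv\<close> so that the recursion is
  well-founded also when \<open>t\<^sup>w = t\<close>; lemma \<open>rv_eq\<close> gives the equation without the cut-off.\<close>

primrec weight :: "'a cterm \<Rightarrow> nat" where
  "weight Zero = 1"
| "weight One = 1"
| "weight (Cond a b) = 2"
| "weight (Neg t) = 1 + weight t"
| "weight (Conj t s) = 1 + weight t + weight s"
| "weight (Disj t s) = 1 + weight t + weight s"

lemma weight_norm: "norm_cterm t = t \<or> weight (norm_cterm t) < weight t"
  by (induction t) (auto simp: mk_defs)

lemma weight_subst_world: "subst_world w t = t \<or> weight (subst_world w t) < weight t"
  by (induction t) auto

lemma weight_reduct: "reduct w t = t \<or> weight (reduct w t) < weight t"
  unfolding reduct_def using weight_norm[of "subst_world w t"] weight_subst_world[of w t]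
  by (metis less_trans)

lemma reduct_eq_imp_subst_world_eq: "reduct w t = t \<Longrightarrow> subst_world w t = t"
  unfolding reduct_def using weight_norm[of "subst_world w t"] weight_subst_world[of w t]
  by (metis less_asym)

lemma subst_world_neq:
  "v \<in> worlds \<Longrightarrow> v \<le> disj_antecedents t \<Longrightarrow> subst_world v t \<noteq> t"
proof (induction t)
  case (Cond a b)
  then show ?case using world_le_compl[of v a] by auto
qed (auto simp: world_le_sup bot_unique worlds_def)

lemma reduct_neq:
  "v \<in> worlds \<Longrightarrow> t \<noteq> Zero \<Longrightarrow> t \<noteq> One \<Longrightarrow> v \<le> bb t \<Longrightarrow> reduct v t \<noteq> t"
  using subst_world_neq reduct_eq_imp_subst_world_eq by (metis bb_def)

function rv :: "('a::{finite,boolean_algebra} \<Rightarrow> 'a \<Rightarrow> real) \<Rightarrow> 'a cterm \<Rightarrow> 'a \<Rightarrow> real" where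
  "rv P t w =
     (if t = One then 1 else if t = Zero then 0
      else cond_expect P (\<lambda>v. if v \<le> bb (reduct w t) then rv P (reduct w t) v else 0)
             (bb (reduct w t)))"
  by pat_completeness auto
termination
proof (relation "measures [\<lambda>(P, t, w). weight t, \<lambda>(P, t, w). if reduct w t = t then 1 else 0]")
  fix P :: "'a \<Rightarrow> 'a \<Rightarrow> real" and t :: "'a cterm" and w v :: 'a
  assume "t \<noteq> One" "t \<noteq> Zero" "v \<in> worlds" "v \<le> bb (reduct w t)"
  then show "((P, reduct w t, v), P, t, w) \<in>
      measures [\<lambda>(P, t, w). weight t, \<lambda>(P, t, w). if reduct w t = t then 1 else 0]"
    using weight_reduct[of w t] reduct_neq[of v t] by (cases "reduct w t = t") auto
qed simp

declare rv.simps [simp del]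

lemma disj_antecedents_norm_neq_bot:
  "wf_cterm t \<Longrightarrow> norm_cterm t \<noteq> Zero \<Longrightarrow> norm_cterm t \<noteq> One \<Longrightarrow>
    disj_antecedents (norm_cterm t) \<noteq> bot"
  by (induction t) (auto simp: mk_defs sup_eq_bot_iff split: if_splits)

lemma wf_subst_world: "wf_cterm t \<Longrightarrow> wf_cterm (subst_world w t)"
  by (induction t) auto

lemma cond_prob_disjoint:
  assumes "cond_prob P" "b \<noteq> bot" "inf a b = bot"
  shows "P a b = 0"
proof -
  have bounds: "0 \<le> P x b" "P x b \<le> 1" for x
    using assms(1,2) unfolding cond_prob_def by blast+
  have "P (sup a b) b = P a b + P b b" "P b b = 1"
    using assms unfolding cond_prob_def by blast+
  then show ?thesis using bounds(1)[of a] bounds(2)[of "sup a b"] by linarith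
qed

lemma rv_eq:
  fixes P :: "'a::{finite,boolean_algebra} \<Rightarrow> 'a \<Rightarrow> real"
  assumes "cond_prob P" "t \<in> cterms" "t \<noteq> Zero" "t \<noteq> One" "(bot :: 'a) \<noteq> top"
  shows "rv P t w = cond_expect P (rv P (reduct w t)) (bb (reduct w t))"
proof -
  let ?b = "bb (reduct w t)"
  have "?b \<noteq> bot"
    using assms disj_antecedents_norm_neq_bot[OF wf_subst_world, of t w]
    by (auto simp: bb_def reduct_def cterms_def)
  then have "P v ?b = 0" if "v \<in> worlds" "\<not> v \<le> ?b" for v
    using that world_le_or_disjoint[of v ?b] cond_prob_disjoint assms(1) by blast
  then have "(if v \<le> ?b then rv P (reduct w t) v else 0) * P v ?b = rv P (reduct w t) v * P v ?b"
    if "v \<in> worlds" for v using that by auto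
  then have "cond_expect P (\<lambda>v. if v \<le> ?b then rv P (reduct w t) v else 0) ?b =
      cond_expect P (rv P (reduct w t)) ?b"
    unfolding cond_expect_def by (rule sum.cong[OF refl])
  then show ?thesis using assms(3,4) by (subst rv.simps) simp
qed


definition cond_equiv :: "('a::{finite,boolean_algebra} cterm \<times> 'a cterm) set" where
  "cond_equiv = {(t, s). t \<in> cterms \<and> s \<in> cterms \<and>
     (\<forall>P. cond_prob P \<longrightarrow> (\<forall>w\<in>worlds. rv P t w = rv P s w))}"

definition cond_class :: "'a::{finite,boolean_algebra} cterm \<Rightarrow> 'a cterm set" where
  "cond_class t = cond_equiv `` {t}"

lemma equiv_cond_equiv: "equiv cterms cond_equiv"
  by (auto simp: equiv_def cond_equiv_def refl_on_def sym_def trans_def)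

record 'b bool_alg =
  ba_carrier :: "'b set"
  ba_meet :: "'b \<Rightarrow> 'b \<Rightarrow> 'b"
  ba_join :: "'b \<Rightarrow> 'b \<Rightarrow> 'b"
  ba_compl :: "'b \<Rightarrow> 'b"
  ba_zero :: 'b
  ba_one :: 'b

definition ba_le :: "'b bool_alg \<Rightarrow> 'b \<Rightarrow> 'b \<Rightarrow> bool" where
  "ba_le B x y \<longleftrightarrow> ba_meet B x y = x"

definition ba_atoms :: "'b bool_alg \<Rightarrow> 'b set" where
  "ba_atoms B = {x \<in> ba_carrier B. x \<noteq> ba_zero B \<and>
     (\<forall>y\<in>ba_carrier B. ba_le B y x \<longrightarrow> y = ba_zero B \<or> y = x)}"

text \<open>The operations on classes are the unions of the classes obtained from representatives.\<close>

definition cond_algebra :: "'a::{finite,boolean_algebra} cterm set bool_alg" where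
  "cond_algebra = \<lparr>
     ba_carrier = cterms // cond_equiv,
     ba_meet = (\<lambda>C D. \<Union>t\<in>C. \<Union>s\<in>D. cond_class (Conj t s)),
     ba_join = (\<lambda>C D. \<Union>t\<in>C. \<Union>s\<in>D. cond_class (Disj t s)),
     ba_compl = (\<lambda>C. \<Union>t\<in>C. cond_class (Neg t)),
     ba_zero = cond_class (Cond bot top),
     ba_one = cond_class (Cond top top)\<rparr>"


text \<open>The empty conjunction (needed for \<open>n = 1\<close>) is the constant \<open>1\<close>.\<close>

fun conj_list :: "'a cterm list \<Rightarrow> 'a cterm" where
  "conj_list [] = One"
| "conj_list [t] = t"
| "conj_list (t # ts) = Conj t (conj_list ts)"

definition inf_compls :: "'a::boolean_algebra list \<Rightarrow> 'a" where
  "inf_compls bs = foldr (\<lambda>b c. inf (- b) c) bs top"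

definition omega :: "'a::boolean_algebra list \<Rightarrow> 'a cterm" where
  "omega bs = conj_list (map (\<lambda>i. Cond (bs ! i) (inf_compls (take i bs))) [0..<length bs])"

end

theory Submission
  imports Defs
begin

text \<open>An ordering of the worlds decides the basic conditional \<open>(a | b)\<close> by its first world
  below \<open>b\<close>, and hence decides every term. A conditional probability \<open>P\<close> induces a random
  ordering: draw worlds one after the other without replacement, each according to \<open>P\<close>
  conditioned on the worlds not drawn yet. By the product rule, the induced ordering of the
  worlds below \<open>b\<close> is distributed as if one had started drawing from \<open>b\<close>, and therefore
  \<open>X\<^sub>t(w)\<close> is the probability that \<open>t\<close> is true given that the ordering starts with \<open>w\<close>.
  Conversely, every ordering arises with probability one from the \<open>{0,1}\<close>-valued conditional
  probability that it induces. Hence two terms are equivalent iff they are true at the same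
  orderings, and \<open>\<omega>\<^bsub>\<langle>\<beta>\<rangle>\<^esub>\<close> is true at exactly one ordering, the one that extends \<open>\<beta>\<close>.\<close>

section \<open>Worlds below an element\<close>

definition below :: "'a::boolean_algebra \<Rightarrow> 'a set" where
  "below b = {w \<in> worlds. w \<le> b}"

lemma below_bot [simp]: "below bot = {}"
  by (auto simp: below_def worlds_def bot_unique)

lemma below_top [simp]: "below top = worlds"
  by (simp add: below_def)

lemma world_le_world: "v \<in> worlds \<Longrightarrow> w \<in> worlds \<Longrightarrow> v \<le> w \<longleftrightarrow> v = w"
  by (auto simp: worlds_def)

lemma below_remove:
  assumes "v \<in> below b"
  shows "below (inf b (- v)) = below b - {v}"
  using assms by (auto simp: below_def world_le_compl world_le_world)

lemma ex_below:
  fixes b :: "'a::{finite,boolean_algebra}"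
  assumes "b \<noteq> bot"
  shows "\<exists>w. w \<in> below b"
proof -
  obtain m where m: "m \<noteq> bot" "m \<le> b"
    and min: "\<And>x. x \<noteq> bot \<Longrightarrow> x \<le> b \<Longrightarrow> x \<le> m \<Longrightarrow> m = x"
    using finite_has_minimal2[of "{x. x \<noteq> bot \<and> x \<le> b}" b] assms by auto
  then have "m \<in> worlds"
    unfolding worlds_def by (auto dest: order_trans)
  then show ?thesis using m by (auto simp: below_def)
qed

lemma card_below_remove:
  fixes b :: "'a::{finite,boolean_algebra}"
  assumes "v \<in> below b"
  shows "card (below (inf b (- v))) < card (below b)"
  using assms by (simp add: below_remove card_Diff1_less del: card_Diff_insert)

text \<open>Induction on the number of worlds below \<open>b\<close>, shaped to match drawing worlds
  one at a time without replacement.\<close>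

lemma remove_world_induct [case_names bot remove]:
  fixes b :: "'a::{finite,boolean_algebra}"
  assumes "Q bot"
    and step: "\<And>b. b \<noteq> bot \<Longrightarrow> (\<And>v. v \<in> below b \<Longrightarrow> Q (inf b (- v))) \<Longrightarrow> Q b"
  shows "Q b"
proof (induction "card (below b)" arbitrary: b rule: less_induct)
  case less
  show ?case
  proof (cases "b = bot")
    case False
    have "Q (inf b (- v))" if "v \<in> below b" for v
      using card_below_remove[OF that] by (rule less)
    with False show ?thesis by (rule step)
  qed (simp add: assms(1))
qed

section \<open>Conditional probabilities on worlds\<close>

context
  fixes P :: "'a::{finite,boolean_algebra} \<Rightarrow> 'a \<Rightarrow> real"
  assumes P: "cond_prob P"
begin

lemma cond_prob_sum:
  assumes c: "c \<noteq> bot"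
  shows "P a c = (\<Sum>v\<in>below a. P v c)"
proof (induction a rule: remove_world_induct)
  case bot
  show ?case using cond_prob_disjoint[OF P c, of bot] by simp
next
  case (remove a)
  then obtain v where v: "v \<in> below a" using ex_below by blast
  have "sup (inf a (- v)) v = a"
    using v by (simp add: below_def sup_inf_distrib2 sup.absorb1)
  moreover have "P (sup (inf a (- v)) v) c = P (inf a (- v)) c + P v c"
    using P c unfolding cond_prob_def by (simp add: inf_assoc)
  ultimately have "P a c = P (inf a (- v)) c + P v c" by simp
  also have "\<dots> = (\<Sum>v\<in>below a. P v c)"
    using v by (simp add: remove below_remove sum.remove[of _ v])
  finally show ?case .
qed

text \<open>This is the product rule with \<open>inf v b = v\<close> and \<open>inf b c = b\<close>:
  drawing \<open>v\<close> from \<open>c\<close> amounts to landing in \<open>b\<close> and then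
  drawing \<open>v\<close> from \<open>b\<close>.\<close>

lemma cond_prob_chain:
  assumes "b \<noteq> bot" "v \<le> b" "b \<le> c"
  shows "P v c = P v b * P b c"
  using P assms unfolding cond_prob_def by (metis inf.absorb1)

lemma cond_prob_sum_below:
  "c \<noteq> bot \<Longrightarrow> (\<Sum>v\<in>below c. P v c) = 1"
  using cond_prob_sum[of c c] P by (simp add: cond_prob_def)

lemma cond_expect_below:
  assumes "b \<noteq> bot"
  shows "cond_expect P X b = (\<Sum>v\<in>below b. P v b * X v)"
proof -
  have "P v b = 0" if "v \<in> worlds - below b" for v
    using that world_le_or_disjoint[of v b] cond_prob_disjoint[OF P assms]
    by (auto simp: below_def)
  then have "(\<Sum>v\<in>below b. P v b * X v) = (\<Sum>v\<in>worlds. P v b * X v)"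
    by (intro sum.mono_neutral_left) (auto simp: below_def)
  then show ?thesis by (simp add: cond_expect_def mult.commute)
qed

end

section \<open>Truth of a term at an ordering\<close>

text \<open>If no world of \<open>l\<close> lies below \<open>b\<close>, the conditional counts as
  false. This default can occur for partial lists, but not for an enumeration of all worlds with
  \<open>b\<close> different from \<open>bot\<close>.\<close>

primrec holds :: "'a::boolean_algebra list \<Rightarrow> 'a cterm \<Rightarrow> bool" where
  "holds l Zero \<longleftrightarrow> False"
| "holds l One \<longleftrightarrow> True"
| "holds l (Cond a b) \<longleftrightarrow> (\<exists>v. find (\<lambda>w. w \<le> b) l = Some v \<and> v \<le> a)"
| "holds l (Neg t) \<longleftrightarrow> \<not> holds l t"
| "holds l (Conj t s) \<longleftrightarrow> holds l t \<and> holds l s"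
| "holds l (Disj t s) \<longleftrightarrow> holds l t \<or> holds l s"

lemma holds_norm: "holds l (norm_cterm t) \<longleftrightarrow> holds l t"
proof (induction t)
  case (Neg t)
  show ?case unfolding holds.simps norm_cterm.simps Neg[symmetric] by (auto simp: mk_neg_def)
next
  case (Conj t s)
  show ?case unfolding holds.simps norm_cterm.simps Conj[symmetric] by (auto simp: mk_conj_def)
next
  case (Disj t s)
  show ?case unfolding holds.simps norm_cterm.simps Disj[symmetric] by (auto simp: mk_disj_def)
qed simp_all

text \<open>A world \<open>w\<close> put in front decides exactly the conditionals whose antecedent
  holds at \<open>w\<close>; for all others \<open>find\<close> skips \<open>w\<close>.\<close>

lemma holds_subst_world:
  "w \<in> worlds \<Longrightarrow> holds l (subst_world w t) \<longleftrightarrow> holds (w # l) t"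
  by (induction t) (auto simp: world_le_compl)

lemma holds_reduct: "w \<in> worlds \<Longrightarrow> holds l (reduct w t) \<longleftrightarrow> holds (w # l) t"
  by (simp add: reduct_def holds_norm holds_subst_world)

lemma wf_reduct: "wf_cterm t \<Longrightarrow> wf_cterm (reduct w t)"
proof -
  have "wf_cterm (norm_cterm t)" if "wf_cterm t" for t :: "'a cterm"
    using that by (induction t) (auto simp: mk_defs)
  then show "wf_cterm t \<Longrightarrow> wf_cterm (reduct w t)"
    by (simp add: reduct_def wf_subst_world)
qed

lemma disj_antecedents_norm_le: "disj_antecedents (norm_cterm t) \<le> disj_antecedents t"
  by (induction t) (auto simp: mk_defs intro: le_supI1 le_supI2)

lemma not_le_disj_antecedents_subst_world:
  "w \<in> worlds \<Longrightarrow> \<not> w \<le> disj_antecedents (subst_world w t)"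
  by (induction t) (auto simp: world_le_sup world_le_compl, auto simp: worlds_def bot_unique)

text \<open>Every conditional whose antecedent holds at \<open>w\<close> has been replaced by a
  constant, and normalisation introduces no new antecedents.\<close>

lemma disj_antecedents_reduct_le:
  assumes "w \<in> worlds"
  shows "disj_antecedents (reduct w t) \<le> - w"
proof -
  have "\<not> w \<le> disj_antecedents (reduct w t)"
    using assms disj_antecedents_norm_le not_le_disj_antecedents_subst_world order_trans
    unfolding reduct_def by blast
  then have "w \<le> - disj_antecedents (reduct w t)"
    using assms by (simp add: world_le_compl)
  then show ?thesis by (rule compl_le_swap1)
qed

lemma find_filter_of_imp:
  assumes "\<And>x. p x \<Longrightarrow> q x"
  shows "find p (filter q l) = find p l"
  using assms by (induction l) auto

text \<open>Truth of \<open>t\<close> depends only on the first world below each antecedent, and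
  these worlds survive the filter.\<close>

lemma holds_filter:
  "disj_antecedents t \<le> b \<Longrightarrow> holds (filter (\<lambda>w. w \<le> b) l) t \<longleftrightarrow> holds l t"
  by (induction t) (auto simp: find_filter_of_imp)

section \<open>The random ordering induced by a conditional probability\<close>

text \<open>The expected value of \<open>F\<close> at the random enumeration of
  \<open>below b\<close>, drawn without replacement. The distribution is given only through its
  expectations, so the worlds already drawn are absorbed into \<open>F\<close>.\<close>

function perm_expect ::
  "('a::{finite,boolean_algebra} \<Rightarrow> 'a \<Rightarrow> real) \<Rightarrow> 'a \<Rightarrow> ('a list \<Rightarrow> real) \<Rightarrow> real" where
  "perm_expect P b F =
     (if b = bot then F []
      else \<Sum>v\<in>below b. P v b * perm_expect P (inf b (- v)) (\<lambda>l. F (v # l)))"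
  by pat_completeness auto
termination
  by (relation "measure (\<lambda>(P, b, F). card (below b))") (simp_all add: card_below_remove)

declare perm_expect.simps [simp del]

lemma perm_expect_bot [simp]: "perm_expect P bot F = F []"
  by (simp add: perm_expect.simps)

lemma perm_expect_step:
  "b \<noteq> bot \<Longrightarrow> perm_expect P b F =
    (\<Sum>v\<in>below b. P v b * perm_expect P (inf b (- v)) (\<lambda>l. F (v # l)))"
  by (subst perm_expect.simps) simp

lemma perm_expect_cong:
  assumes "\<And>l. distinct l \<Longrightarrow> set l = below b \<Longrightarrow> F l = G l"
  shows "perm_expect P b F = perm_expect P b G"
  using assms
proof (induction b arbitrary: F G rule: remove_world_induct)
  case bot
  then show ?case by simp
next
  case (remove b)
  have "perm_expect P (inf b (- v)) (\<lambda>l. F (v # l)) = perm_expect P (inf b (- v)) (\<lambda>l. G (v # l))"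
    if v: "v \<in> below b" for v
  proof (rule remove.IH[OF v])
    fix l assume "distinct l" "set l = below (inf b (- v))"
    moreover have "below (inf b (- v)) = below b - {v}"
      using v by (rule below_remove)
    ultimately show "F (v # l) = G (v # l)"
      using v by (intro remove.prems) auto
  qed
  then show ?case using remove.hyps by (simp add: perm_expect_step)
qed

text \<open>The key invariance: if \<open>F\<close> sees only the worlds below \<open>b\<close>,
  drawing may start from \<open>b\<close> instead of \<open>c\<close>. A first draw outside
  \<open>b\<close> is invisible to \<open>F\<close>, and induction applies to the remaining worlds.
  For first draws \<open>v\<close> inside \<open>b\<close>, the chain rule factors
  \<open>P v c\<close> as \<open>P v b * P b c\<close>, so together they contribute
  \<open>P b c\<close> times the expectation from \<open>b\<close>. The weights of both kinds sum to
  one.\<close>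

lemma perm_expect_restrict:
  assumes P: "cond_prob P" and "b \<le> c"
    and "\<And>l. set l \<subseteq> below c \<Longrightarrow> F (filter (\<lambda>w. w \<le> b) l) = F l"
  shows "perm_expect P c F = perm_expect P b F"
  using assms(2,3)
proof (induction c arbitrary: b F rule: remove_world_induct)
  case bot
  then show ?case by (simp add: bot_unique)
next
  case (remove c)
  note c = \<open>c \<noteq> bot\<close> and bc = \<open>b \<le> c\<close> and F = remove.prems(2)
  let ?E = "\<lambda>b v. perm_expect P (inf b (- v)) (\<lambda>l. F (v # l))"
  have inside: "?E c v = ?E b v" if v: "v \<in> below b" for v
  proof (rule remove.IH)
    show v': "v \<in> below c" using v bc by (auto simp: below_def)
    show "inf b (- v) \<le> inf c (- v)" using bc by (rule inf_mono) simp
    fix l assume l: "set l \<subseteq> below (inf c (- v))"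
    then have "set l \<subseteq> below c - {v}" using v' by (simp add: below_remove)
    moreover have "filter (\<lambda>w. w \<le> inf b (- v)) l = filter (\<lambda>w. w \<le> b) l"
      using l by (intro filter_cong) (auto simp: below_def)
    ultimately show "F (v # filter (\<lambda>w. w \<le> inf b (- v)) l) = F (v # l)"
      using F[of "v # l"] F[of "v # filter (\<lambda>w. w \<le> b) l"] v v' by (auto simp: below_def)
  qed
  have outside: "?E c v = perm_expect P b F" if v: "v \<in> below c - below b" for v
  proof -
    have nle: "\<not> v \<le> b" using v by (auto simp: below_def)
    \<comment> \<open>As \<open>v\<close> is not below \<open>b\<close>, the lists
      \<open>v # l\<close> and \<open>l\<close> become equal after filtering.\<close>
    have "F (v # l) = F l" if "set l \<subseteq> below c" for l
      using F[of "v # l"] F[of l] that v nle by auto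
    then have "?E c v = perm_expect P (inf c (- v)) F"
      using v by (intro perm_expect_cong) (auto simp: below_def)
    also have "\<dots> = perm_expect P b F"
    proof (rule remove.IH)
      show "v \<in> below c" using v by simp
      have "v \<le> - b" using v nle by (simp add: below_def world_le_compl)
      then show "b \<le> inf c (- v)" using bc by (simp add: compl_le_swap1)
      show "F (filter (\<lambda>w. w \<le> b) l) = F l" if "set l \<subseteq> below (inf c (- v))" for l
        using that by (intro F) (auto simp: below_def)
    qed
    finally show ?thesis .
  qed
  have sub: "below b \<subseteq> below c" using bc by (auto simp: below_def)
  have split: "(\<Sum>v\<in>below c. g v) = (\<Sum>v\<in>below c - below b. g v) + (\<Sum>v\<in>below b. g v)"
    for g :: "'a \<Rightarrow> real"
    using sub by (intro sum.subset_diff) simp_all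
  have b_part: "(\<Sum>v\<in>below b. P v c * ?E b v) = (\<Sum>v\<in>below b. P v c) * perm_expect P b F"
  \<comment> \<open>The chain rule needs \<open>b\<close> different from \<open>bot\<close>; for
    \<open>bot\<close> both sums are empty.\<close>
  proof (cases "b = bot")
    case False
    have "(\<Sum>v\<in>below b. P v c * ?E b v) = (\<Sum>v\<in>below b. P b c * (P v b * ?E b v))"
    proof (rule sum.cong)
      fix v assume "v \<in> below b"
      then have "P v c = P v b * P b c"
        using bc by (intro cond_prob_chain[OF P False]) (simp_all add: below_def)
      then show "P v c * ?E b v = P b c * (P v b * ?E b v)" by simp
    qed simp
    also have "\<dots> = P b c * perm_expect P b F"
      using False by (simp add: perm_expect_step sum_distrib_left)
    finally show ?thesis using cond_prob_sum[OF P c, of b] by simp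
  qed simp
  have "perm_expect P c F =
      (\<Sum>v\<in>below c - below b. P v c * ?E c v) + (\<Sum>v\<in>below b. P v c * ?E c v)"
    using c by (simp add: perm_expect_step split)
  also have "\<dots> = (\<Sum>v\<in>below c - below b. P v c) * perm_expect P b F
      + (\<Sum>v\<in>below b. P v c) * perm_expect P b F"
    using inside outside b_part by (simp add: sum_distrib_right)
  also have "\<dots> = (\<Sum>v\<in>below c. P v c) * perm_expect P b F"
    unfolding split by (simp add: distrib_right)
  finally show ?case using cond_prob_sum_below[OF P c] by simp
qed

text \<open>A constant ignores all worlds, so the drawing can be restricted to \<open>bot\<close>,
  where only the empty list remains.\<close>

lemma perm_expect_const:
  assumes "cond_prob P"
  shows "perm_expect P b (\<lambda>l. k) = k"
  using perm_expect_restrict[OF assms, of bot b "\<lambda>l. k"] by simp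

text \<open>Induction along the recursion of \<open>rv\<close>. Passing to the reduct
  \<open>r\<close> accounts for the leading \<open>w\<close>; averaging the values of
  \<open>r\<close> over the worlds below its antecedents is one draw from their disjunction
  \<open>b\<close>; finally \<open>perm_expect_restrict\<close> enlarges \<open>b\<close> to
  \<open>- w\<close>.\<close>

lemma rv_eq_perm_expect:
  fixes P :: "'a::{finite,boolean_algebra} \<Rightarrow> 'a \<Rightarrow> real"
  assumes P: "cond_prob P" and nontriv: "(bot :: 'a) \<noteq> top"
    and "wf_cterm t" "w \<in> worlds"
  shows "rv P t w = perm_expect P (- w) (\<lambda>l. of_bool (holds (w # l) t))"
  using P assms(3,4)
proof (induction P t w rule: rv.induct)
  case (1 P t w)
  note P = \<open>cond_prob P\<close> and w = \<open>w \<in> worlds\<close>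
  define r where "r = reduct w t"
  let ?F = "\<lambda>l. of_bool (holds l r) :: real"
  \<comment> \<open>A constant reduct needs its own case: there \<open>bb r\<close> is
    \<open>top\<close> by convention, although \<open>disj_antecedents r\<close> is
    \<open>bot\<close>.\<close>
  consider "t = Zero \<or> t = One" | "t \<noteq> Zero" "t \<noteq> One" "r = Zero \<or> r = One"
    | "t \<noteq> Zero" "t \<noteq> One" "r \<noteq> Zero" "r \<noteq> One"
    by blast
  then show ?case
  proof cases
    case 1
    then show ?thesis by (auto simp: rv.simps perm_expect_const[OF P])
  next
    case 2
    have "rv P t w = cond_expect P (rv P r) (bb r)"
      using 2 rv_eq[OF P, of t w] "1.prems" nontriv by (simp add: cterms_def r_def)
    also have "\<dots> = cond_expect P (\<lambda>v. of_bool (r = One)) top"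
      using 2 by (auto simp: rv.simps bb_def cond_expect_def)
    also have "\<dots> = of_bool (r = One)"
      using cond_prob_sum_below[OF P, of top] nontriv
      by (auto simp: cond_expect_below[OF P] simp flip: sum_distrib_right)
    also have "\<dots> = perm_expect P (- w) (\<lambda>l. of_bool (holds l r))"
      using 2 by (auto simp: perm_expect_const[OF P])
    finally show ?thesis using w by (simp add: r_def holds_reduct)
  next
    case 3
    define b where "b = disj_antecedents r"
    have bb: "bb r = b" using 3 by (simp add: bb_def b_def)
    have wf: "wf_cterm r"
      using "1.prems" by (simp add: r_def wf_reduct)
    have b: "b \<noteq> bot"
      using 3 "1.prems" disj_antecedents_norm_neq_bot[OF wf_subst_world, of t w]
      by (auto simp: b_def r_def reduct_def)
    have le: "b \<le> - w" using w by (simp add: b_def r_def disj_antecedents_reduct_le)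
    have F: "?F (filter (\<lambda>w. w \<le> b) l) = ?F l" for l
      by (simp add: holds_filter b_def)
    have IH: "rv P r v = perm_expect P (inf b (- v)) (\<lambda>l. ?F (v # l))" if v: "v \<in> below b" for v
    proof -
      \<comment> \<open>The induction hypothesis draws from \<open>- v\<close>, whereas a draw of
        \<open>v\<close> from \<open>b\<close> leaves \<open>inf b (- v)\<close>; invariance under
        restriction bridges the two.\<close>
      have "rv P r v = perm_expect P (- v) (\<lambda>l. ?F (v # l))"
        using 3 v bb wf P unfolding r_def
        by (intro "1.IH") (auto simp: below_def)
      also have "\<dots> = perm_expect P (inf b (- v)) (\<lambda>l. ?F (v # l))"
      proof (rule perm_expect_restrict[OF P])
        fix l assume l: "set l \<subseteq> below (- v)"
        have "filter (\<lambda>w. w \<le> inf b (- v)) l = filter (\<lambda>w. w \<le> b) l"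
          using l by (intro filter_cong) (auto simp: below_def)
        then show "?F (v # filter (\<lambda>w. w \<le> inf b (- v)) l) = ?F (v # l)"
          using F[of "v # l"] F[of "v # filter (\<lambda>w. w \<le> b) l"] v by (simp add: below_def)
      qed simp
      finally show ?thesis .
    qed
    have "rv P t w = cond_expect P (rv P r) b"
      using 3 rv_eq[OF P, of t w] "1.prems" nontriv bb by (simp add: cterms_def r_def)
    also have "\<dots> = (\<Sum>v\<in>below b. P v b * perm_expect P (inf b (- v)) (\<lambda>l. ?F (v # l)))"
      using b IH by (simp add: cond_expect_below[OF P])
    also have "\<dots> = perm_expect P b ?F"
      using b by (rule perm_expect_step[symmetric])
    also have "\<dots> = perm_expect P (- w) ?F"
      using perm_expect_restrict[OF P le, of ?F] F by simp
    finally show ?thesis using w by (simp add: r_def holds_reduct)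
  qed
qed

section \<open>Equivalence of terms\<close>

definition orderings :: "'a::boolean_algebra list set" where
  "orderings = {l. distinct l \<and> set l = worlds}"

definition order_prob :: "'a::boolean_algebra list \<Rightarrow> 'a \<Rightarrow> 'a \<Rightarrow> real" where
  "order_prob l a b = of_bool (holds l (Cond a b))"

lemma find_ordering:
  fixes b :: "'a::{finite,boolean_algebra}"
  assumes "set l = worlds" "b \<noteq> bot"
  obtains v where "find (\<lambda>w. w \<le> b) l = Some v" "v \<in> below b"
proof (cases "find (\<lambda>w. w \<le> b) l")
  case None
  then show ?thesis using ex_below[OF assms(2)] assms(1) by (auto simp: find_None_iff below_def)
next
  case (Some v)
  then have "v \<in> below b" using assms(1) by (auto simp: find_Some_iff below_def)
  with Some show ?thesis by (rule that)
qed

text \<open>Additivity holds because the first world below \<open>b\<close> lies in at most one of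
  two disjoint elements. For the product rule, if the first world below \<open>c\<close> lies in
  \<open>b\<close>, it is also the first world below \<open>inf b c\<close>; otherwise both sides
  vanish.\<close>

lemma cond_prob_order_prob:
  fixes l :: "'a::{finite,boolean_algebra} list"
  assumes l: "set l = worlds"
  shows "cond_prob (order_prob l)"
  unfolding cond_prob_def
proof (intro conjI allI impI)
  fix a b c :: 'a
  show "order_prob l top b = 1" "order_prob l b b = 1" if "b \<noteq> bot"
    using find_ordering[OF l that] by (auto simp: order_prob_def below_def)
  show "order_prob l (sup a c) b = order_prob l a b + order_prob l c b"
    if b: "b \<noteq> bot" and ac: "inf a c = bot"
  proof -
    obtain v where v: "find (\<lambda>w. w \<le> b) l = Some v" "v \<in> worlds"
      using find_ordering[OF l b] by (auto simp: below_def)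
    have "\<not> (v \<le> a \<and> v \<le> c)"
      using v(2) ac by (metis le_inf_iff below_bot below_def empty_iff mem_Collect_eq)
    then show ?thesis using v by (auto simp: order_prob_def world_le_sup)
  qed
  show "order_prob l (inf a b) c = order_prob l a (inf b c) * order_prob l b c"
    if bc: "inf b c \<noteq> bot"
  proof -
    have "c \<noteq> bot" using bc by auto
    then obtain v where v: "find (\<lambda>w. w \<le> c) l = Some v" "v \<in> below c"
      using find_ordering[OF l] by blast
    have "find (\<lambda>w. w \<le> inf b c) l = Some v" if "v \<le> b"
      using v(1) that by (induction l) (auto split: if_splits)
    then show ?thesis using v by (auto simp: order_prob_def)
  qed
qed (auto simp: order_prob_def)

text \<open>Each draw is deterministic and yields the earliest remaining world of \<open>l\<close>,
  so the enumeration obtained is \<open>l\<close> restricted to \<open>b\<close>.\<close>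

lemma perm_expect_order_prob:
  fixes b :: "'a::{finite,boolean_algebra}"
  assumes l: "l \<in> orderings"
  shows "perm_expect (order_prob l) b F = F (filter (\<lambda>w. w \<le> b) l)"
proof (induction b arbitrary: F rule: remove_world_induct)
  case bot
  have "filter (\<lambda>w. w \<le> bot) l = []"
    using l by (auto simp: orderings_def filter_empty_conv worlds_def bot_unique)
  then show ?case by simp
next
  case (remove b)
  have dist: "distinct l" and set: "set l = worlds" using l by (auto simp: orderings_def)
  obtain v where v: "find (\<lambda>w. w \<le> b) l = Some v" "v \<in> below b"
    using find_ordering[OF set remove.hyps] by blast
  have eq: "filter (\<lambda>w. w \<le> b) l = v # filter (\<lambda>w. w \<le> inf b (- v)) l"
  proof -
    have "filter (\<lambda>w. w \<le> inf b (- v)) l = filter (\<lambda>w. w \<noteq> v) (filter (\<lambda>w. w \<le> b) l)"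
      unfolding filter_filter
      using set v(2) by (intro filter_cong) (auto simp: below_def world_le_compl world_le_world)
    \<comment> \<open>By distinctness, deleting \<open>v\<close> removes only the head of the
      filtered list.\<close>
    moreover have "filter (\<lambda>w. w \<noteq> v) (filter (\<lambda>w. w \<le> b) l) = tl (filter (\<lambda>w. w \<le> b) l)"
      "filter (\<lambda>w. w \<le> b) l \<noteq> [] \<and> hd (filter (\<lambda>w. w \<le> b) l) = v"
      using v(1) dist by (induction l) (auto split: if_splits intro!: filter_cong)
    ultimately show ?thesis by (metis list.collapse)
  qed
  have prob: "order_prob l u b = of_bool (u = v)" if "u \<in> below b" for u
    using that v by (auto simp: order_prob_def below_def world_le_world)
  have "perm_expect (order_prob l) b F =
      (\<Sum>u\<in>below b. of_bool (u = v) * F (u # filter (\<lambda>w. w \<le> inf b (- u)) l))"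
    using remove by (simp add: perm_expect_step prob)
  also have "\<dots> = F (filter (\<lambda>w. w \<le> b) l)"
    using v(2) by (simp add: eq of_bool_def if_distrib[of "\<lambda>x. x * _"] cong: if_cong)
  finally show ?case .
qed

lemma rv_order_prob:
  fixes l :: "'a::{finite,boolean_algebra} list"
  assumes nontriv: "(bot :: 'a) \<noteq> top" and "wf_cterm t" and l: "w # l \<in> orderings"
  shows "rv (order_prob (w # l)) t w = of_bool (holds (w # l) t)"
proof -
  have w: "w \<in> worlds" "cond_prob (order_prob (w # l))"
    using l cond_prob_order_prob[of "w # l"] by (auto simp: orderings_def)
  have "filter (\<lambda>v. v \<le> - w) l = l"
  proof (rule filter_True, rule ballI)
    fix x assume "x \<in> set l"
    then have "x \<in> worlds" "x \<noteq> w" using l by (auto simp: orderings_def)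
    then show "x \<le> - w" using w by (simp add: world_le_compl world_le_world)
  qed
  then have "filter (\<lambda>v. v \<le> - w) (w # l) = l"
    using w by (simp add: world_le_compl)
  then show ?thesis
    using assms w by (simp add: rv_eq_perm_expect perm_expect_order_prob)
qed

context
  assumes nontriv: "(bot :: 'a::{finite,boolean_algebra}) \<noteq> top"
begin

lemma orderings_nonempty: "[] \<notin> (orderings :: 'a list set)"
  using ex_below[OF nontriv[symmetric]] by (auto simp: orderings_def)

text \<open>From left to right, \<open>order_prob l\<close> evaluated at the head of
  \<open>l\<close> reads off truth at \<open>l\<close>. Conversely, \<open>rv P t w\<close> averages
  the truth of \<open>t\<close> over orderings that start with \<open>w\<close>.\<close>

lemma cond_equiv_iff_holds:
  fixes t s :: "'a cterm"
  assumes wf: "wf_cterm t" "wf_cterm s"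
  shows "(t, s) \<in> cond_equiv \<longleftrightarrow> (\<forall>l\<in>orderings. holds l t \<longleftrightarrow> holds l s)"
proof
  assume eq: "(t, s) \<in> cond_equiv"
  show "\<forall>l\<in>orderings. holds l t \<longleftrightarrow> holds l s"
  proof
    fix l :: "'a list" assume l: "l \<in> orderings"
    then obtain w k where lw: "l = w # k" using orderings_nonempty by (cases l) auto
    have "rv (order_prob l) t w = rv (order_prob l) s w"
      using eq l lw cond_prob_order_prob[of l] by (auto simp: cond_equiv_def orderings_def)
    then show "holds l t \<longleftrightarrow> holds l s"
      using rv_order_prob[OF nontriv] wf l by (simp add: lw of_bool_eq_iff del: holds.simps)
  qed
next
  assume eq: "\<forall>l\<in>orderings. holds l t \<longleftrightarrow> holds l s"
  have "rv P t w = rv P s w" if P: "cond_prob P" and w: "w \<in> worlds" for P w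
  proof -
    have "w # l \<in> orderings" if "distinct l" "set l = below (- w)" for l
      using that w below_remove[of w top] by (auto simp: orderings_def)
    then show ?thesis
      using eq P w wf nontriv by (auto simp: rv_eq_perm_expect intro!: perm_expect_cong)
  qed
  then show "(t, s) \<in> cond_equiv" using wf by (auto simp: cond_equiv_def cterms_def)
qed

lemma cond_class_eq_iff:
  fixes t s :: "'a cterm"
  assumes "wf_cterm t" "wf_cterm s"
  shows "cond_class t = cond_class s \<longleftrightarrow> (\<forall>l\<in>orderings. holds l t \<longleftrightarrow> holds l s)"
  using eq_equiv_class_iff[OF equiv_cond_equiv, of t s] assms
  by (simp add: cond_class_def cond_equiv_iff_holds cterms_def)

lemma mem_cond_class_iff:
  fixes t s :: "'a cterm"
  assumes "wf_cterm t"
  shows "s \<in> cond_class t \<longleftrightarrow> wf_cterm s \<and> (\<forall>l\<in>orderings. holds l t \<longleftrightarrow> holds l s)"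
proof (cases "wf_cterm s")
  case True
  then show ?thesis using assms by (simp add: cond_class_def cond_equiv_iff_holds)
qed (auto simp: cond_class_def cond_equiv_def cterms_def)

section \<open>The order and the atoms of the algebra of classes\<close>

lemma cond_algebra_meet:
  fixes t s :: "'a cterm"
  assumes "wf_cterm t" "wf_cterm s"
  shows "ba_meet cond_algebra (cond_class t) (cond_class s) = cond_class (Conj t s)"
proof -
  have eq: "cond_class (Conj t' s') = cond_class (Conj t s)"
    if "t' \<in> cond_class t" "s' \<in> cond_class s" for t' s'
    using that assms by (simp add: cond_class_eq_iff mem_cond_class_iff)
  have "t \<in> cond_class t" "s \<in> cond_class s"
    using assms by (simp_all add: mem_cond_class_iff)
  \<comment> \<open>The union of a constant family equals its common value only over nonempty index
    sets.\<close>
  then have ne: "cond_class t \<noteq> {}" "cond_class s \<noteq> {}" by blast+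
  have "(\<Union>t'\<in>cond_class t. \<Union>s'\<in>cond_class s. cond_class (Conj t' s')) =
      (\<Union>t'\<in>cond_class t. \<Union>s'\<in>cond_class s. cond_class (Conj t s))"
    by (intro SUP_cong refl eq)
  also have "\<dots> = cond_class (Conj t s)" using ne by simp
  finally show ?thesis by (simp add: cond_algebra_def)
qed

lemma cond_algebra_le:
  fixes t s :: "'a cterm"
  assumes "wf_cterm t" "wf_cterm s"
  shows "ba_le cond_algebra (cond_class t) (cond_class s) \<longleftrightarrow>
    (\<forall>l\<in>orderings. holds l t \<longrightarrow> holds l s)"
  using assms by (auto simp: ba_le_def cond_algebra_meet cond_class_eq_iff)

lemma cond_class_eq_zero_iff:
  fixes t :: "'a cterm"
  assumes "wf_cterm t"
  shows "cond_class t = ba_zero cond_algebra \<longleftrightarrow> (\<forall>l\<in>orderings. \<not> holds l t)"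
proof -
  have "\<not> holds l (Cond bot top)" if "l \<in> orderings" for l :: "'a list"
  proof -
    have "\<not> v \<le> bot" if "v \<in> worlds" for v :: 'a
      using that by (simp add: worlds_def bot_unique)
    then show ?thesis using that by (cases l) (auto simp: orderings_def)
  qed
  then show ?thesis
    using assms nontriv by (simp add: cond_algebra_def cond_class_eq_iff del: holds.simps)
qed

lemma cond_algebra_carrier:
  "ba_carrier (cond_algebra :: 'a cterm set bool_alg) = cond_class ` {t. wf_cterm t}"
  by (auto simp: cond_algebra_def quotient_def cond_class_def cterms_def)

text \<open>A class is determined by the set of orderings at which it is true, and the order is
  inclusion of these sets. The terms in \<open>T\<close> realise exactly the singletons, so an atom
  true at \<open>l\<close> lies above the class for \<open>l\<close> and coincides with it.\<close>

lemma cond_algebra_atoms: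
  fixes T :: "'a cterm set"
  assumes single: "\<And>l. l \<in> orderings \<Longrightarrow>
      \<exists>t\<in>T. \<forall>k\<in>orderings. holds k t \<longleftrightarrow> k = l"
    and wf: "\<And>t. t \<in> T \<Longrightarrow> wf_cterm t"
    and uniq: "\<And>t. t \<in> T \<Longrightarrow> \<exists>l\<in>orderings. \<forall>k\<in>orderings. holds k t \<longleftrightarrow> k = l"
  shows "ba_atoms (cond_algebra :: 'a cterm set bool_alg) = cond_class ` T"
proof (intro equalityI subsetI)
  fix C :: "'a cterm set" assume C: "C \<in> ba_atoms cond_algebra"
  then obtain t where t: "C = cond_class t" "wf_cterm t"
    by (auto simp: ba_atoms_def cond_algebra_carrier)
  then obtain l where l: "l \<in> orderings" "holds l t"
    using C by (auto simp: ba_atoms_def cond_class_eq_zero_iff)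
  obtain s where s: "s \<in> T" "\<forall>k\<in>orderings. holds k s \<longleftrightarrow> k = l"
    using single[OF l(1)] by blast
  have "ba_le cond_algebra (cond_class s) C" "cond_class s \<noteq> ba_zero cond_algebra"
    using s t l wf by (auto simp: cond_algebra_le cond_class_eq_zero_iff)
  then have "cond_class s = C"
    using C wf[OF s(1)] by (auto simp: ba_atoms_def cond_algebra_carrier)
  then show "C \<in> cond_class ` T" using s(1) by blast
next
  fix C assume "C \<in> cond_class ` T"
  then obtain t where t: "C = cond_class t" "t \<in> T" by blast
  obtain l where l: "l \<in> orderings" "\<forall>k\<in>orderings. holds k t \<longleftrightarrow> k = l"
    using uniq[OF t(2)] by blast
  have "cond_class s = ba_zero cond_algebra \<or> cond_class s = C"
    if "wf_cterm s" "ba_le cond_algebra (cond_class s) C" for s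
    using that t l wf by (auto simp: cond_algebra_le cond_class_eq_zero_iff cond_class_eq_iff)
  then show "C \<in> ba_atoms cond_algebra"
    using t l wf by (auto simp: ba_atoms_def cond_algebra_carrier cond_class_eq_zero_iff)
qed

end

section \<open>The conjunctions \<open>\<omega>\<close>\<close>

lemma holds_conj_list: "holds l (conj_list ts) \<longleftrightarrow> (\<forall>t\<in>set ts. holds l t)"
  by (induction ts rule: conj_list.induct) auto

lemma wf_conj_list: "wf_cterm (conj_list ts) \<longleftrightarrow> (\<forall>t\<in>set ts. wf_cterm t)"
  by (induction ts rule: conj_list.induct) auto

lemma world_le_inf_compls:
  "w \<in> worlds \<Longrightarrow> set bs \<subseteq> worlds \<Longrightarrow> w \<le> inf_compls bs \<longleftrightarrow> w \<notin> set bs"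
  by (induction bs) (auto simp: inf_compls_def world_le_compl world_le_world)

text \<open>Each antecedent differs from \<open>bot\<close> because \<beta>'s entry at that position
  lies below it, being distinct from all earlier entries.\<close>

lemma wf_omega:
  assumes "set \<beta> \<subseteq> worlds" "distinct \<beta>"
  shows "wf_cterm (omega \<beta>)"
proof -
  have "inf_compls (take i \<beta>) \<noteq> bot" if i: "i < length \<beta>" for i
  proof -
    have "\<beta> ! i \<in> worlds" using assms i by auto
    moreover have "\<beta> ! i \<notin> set (take i \<beta>)"
      using assms(2) i by (auto simp: in_set_conv_nth nth_eq_iff_index_eq)
    ultimately have "\<beta> ! i \<in> below (inf_compls (take i \<beta>))"
      using assms(1) set_take_subset[of i \<beta>] by (auto simp: below_def world_le_inf_compls)
    then show ?thesis by auto
  qed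
  then show ?thesis by (auto simp: omega_def wf_conj_list)
qed

lemma find_notin_take:
  assumes "distinct l" "i < length l"
  shows "find (\<lambda>w. w \<notin> set (take i l)) l = Some (l ! i)"
  unfolding find_Some_iff
  using assms by (intro exI[of _ i]) (auto simp: in_set_conv_nth nth_eq_iff_index_eq)

text \<open>Once \<open>l\<close> and \<open>\<beta>\<close> agree before position \<open>i\<close>,
  the first world of \<open>l\<close> below the antecedent at \<open>i\<close> is
  \<open>l ! i\<close>, so that conditional states \<open>l ! i = \<beta> ! i\<close>. Agreement
  thus propagates along the prefix.\<close>

lemma holds_omega_iff:
  assumes "l \<in> orderings" "set \<beta> \<subseteq> worlds" "length \<beta> \<le> length l"
  shows "holds l (omega \<beta>) \<longleftrightarrow> take (length \<beta>) l = \<beta>"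
proof -
  have l: "distinct l" "set l = worlds" using assms(1) by (auto simp: orderings_def)
  have step: "holds l (Cond (\<beta> ! i) (inf_compls (take i \<beta>))) \<longleftrightarrow> l ! i = \<beta> ! i"
    if i: "i < length \<beta>" and eq: "take i l = take i \<beta>" for i
  proof -
    have "find (\<lambda>w. w \<le> inf_compls (take i \<beta>)) l = find (\<lambda>w. w \<notin> set (take i l)) l"
      using l assms(2) set_take_subset[of i \<beta>]
      by (intro find_cong) (auto simp: world_le_inf_compls eq)
    also have "\<dots> = Some (l ! i)"
      using l i assms(3) by (intro find_notin_take) auto
    finally have "find (\<lambda>w. w \<le> inf_compls (take i \<beta>)) l = Some (l ! i)" .
    moreover have "l ! i \<in> worlds" "\<beta> ! i \<in> worlds"
      using l i assms by (auto simp flip: l(2))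
    ultimately show ?thesis by (simp add: world_le_world)
  qed
  have "(\<forall>i<m. holds l (Cond (\<beta> ! i) (inf_compls (take i \<beta>)))) \<longleftrightarrow> take m l = take m \<beta>"
    if "m \<le> length \<beta>" for m
    using that
  proof (induction m)
    case (Suc m)
    then have "take (Suc m) l = take (Suc m) \<beta> \<longleftrightarrow> take m l = take m \<beta> \<and> l ! m = \<beta> ! m"
      using assms(3) by (simp add: take_Suc_conv_app_nth)
    then show ?case
      using Suc step[of m] by (auto simp: less_Suc_eq simp del: holds.simps)
  qed simp
  from this[of "length \<beta>"] show ?thesis
    by (auto simp: omega_def holds_conj_list simp del: holds.simps)
qed

text \<open>After all but one of the worlds have been listed, the last is forced. This is why one
  conditional fewer than the number of atoms suffices.\<close>

lemma ordering_eqI: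
  fixes l k :: "'a::{finite,boolean_algebra} list"
  assumes "l \<in> orderings" "k \<in> orderings"
    and eq: "take (card (worlds :: 'a set) - 1) l = take (card (worlds :: 'a set) - 1) k"
  shows "l = k"
proof -
  define m where "m = card (worlds :: 'a set) - 1"
  have l: "distinct l" "set l = worlds" "length l = card (worlds :: 'a set)"
    and k: "distinct k" "set k = worlds" "length k = card (worlds :: 'a set)"
    using assms(1,2) distinct_card by (force simp: orderings_def)+
  have drop: "set (drop m xs) = worlds - set (take m xs)"
    if "distinct xs" "set xs = worlds" for xs :: "'a list"
    using that distinct_append[of "take m xs" "drop m xs"] set_append[of "take m xs" "drop m xs"]
    unfolding append_take_drop_id by blast
  have "set (drop m l) = set (drop m k)"
    using eq drop[OF l(1,2)] drop[OF k(1,2)] by (simp add: m_def)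
  moreover have "length (drop m l) \<le> 1" "length (drop m l) = length (drop m k)"
    using l k by (auto simp: m_def)
  ultimately have "drop m l = drop m k"
    by (cases "drop m l"; cases "drop m k") auto
  then show ?thesis using eq by (metis m_def append_take_drop_id)
qed

text \<open>Any enumeration of the remaining worlds can be appended.\<close>

lemma ex_ordering_extending:
  fixes \<beta> :: "'a::{finite,boolean_algebra} list"
  assumes "distinct \<beta>" "set \<beta> \<subseteq> worlds"
  shows "\<exists>l\<in>orderings. take (length \<beta>) l = \<beta>"
proof -
  obtain k where "set k = worlds - set \<beta>" "distinct k"
    using finite_distinct_list[of "worlds - set \<beta>"] by auto
  then show ?thesis
    using assms by (intro bexI[of _ "\<beta> @ k"]) (auto simp: orderings_def)
qed

theorem theorem6p1:
  fixes n :: nat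
  assumes "(bot :: 'a::{finite,boolean_algebra}) \<noteq> top"
    and "card (worlds :: 'a set) = n"
  shows "ba_atoms (cond_algebra :: 'a cterm set bool_alg) =
    {cond_class (omega \<beta>) | \<beta>. set \<beta> \<subseteq> worlds \<and> distinct \<beta> \<and> length \<beta> = n - 1}"
proof -
  let ?S = "{\<beta> :: 'a list. set \<beta> \<subseteq> worlds \<and> distinct \<beta> \<and> length \<beta> = n - 1}"
  have len: "length l = n" if "l \<in> orderings" for l :: "'a list"
    using that assms(2) distinct_card[of l] by (simp add: orderings_def)
  \<comment> \<open>Among the orderings, \<open>l\<close> is the only one with prefix
    \<open>\<beta>\<close>, so \<open>omega \<beta>\<close> corresponds to a singleton.\<close>
  have omega: "holds k (omega \<beta>) \<longleftrightarrow> k = l"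
    if "\<beta> \<in> ?S" "l \<in> orderings" "take (n - 1) l = \<beta>" "k \<in> orderings" for \<beta> k l
    using that len holds_omega_iff[of k \<beta>] ordering_eqI[of k l] assms(2) by auto
  have "ba_atoms (cond_algebra :: 'a cterm set bool_alg) = cond_class ` (omega ` ?S)"
  proof (rule cond_algebra_atoms[OF assms(1)])
    fix l :: "'a list" assume l: "l \<in> orderings"
    have "take (n - 1) l \<in> ?S"
      using l len[OF l] set_take_subset[of "n - 1" l] by (auto simp: orderings_def)
    then show "\<exists>t\<in>omega ` ?S. \<forall>k\<in>orderings. holds k t \<longleftrightarrow> k = l"
      using omega l by blast
  next
    fix t assume "t \<in> omega ` ?S"
    then obtain \<beta> where \<beta>: "t = omega \<beta>" "\<beta> \<in> ?S" by blast
    then show "wf_cterm t" by (simp add: wf_omega)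
    obtain l where "l \<in> orderings" "take (n - 1) l = \<beta>"
      using \<beta>(2) ex_ordering_extending[of \<beta>] by auto
    then show "\<exists>l\<in>orderings. \<forall>k\<in>orderings. holds k t \<longleftrightarrow> k = l"
      using omega \<beta> by blast
  qed
  then show ?thesis by auto
qed

end
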